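(* Let $R$ be a commutative ring with $1\ne0$, $n\ge1$, let $s$ be an $n$-dimensional sequence over $R$ indexed by $-\mathbb{N}^n$, and let $f\in R[X_1,\dots,X_n]$. If $\delta f\ge\mathbf 1$, then $$\beta_0(f,s)=X_1\cdots X_n\sum_{\mathbf 0\le a\le\delta f-\mathbf 1}s_{-a}\ \nu^{a+\mathbf 1}f.$$
   Context: $\mathbb{N}=\{0,1,2,\dots\}$; $\mathbf 0=(0,\dots,0)$, $\mathbf 1=(1,\dots,1)$; vectors are ordered componentwise; $X^a=X_1^{a_1}\cdots X_n^{a_n}$. A sequence is $s:-\mathbb{N}^n\to R$, $a\mapsto s_a$, with generating function $\Gamma(s)=\sum_{a\le\mathbf 0}s_aX^a\in R[[X_1^{-1},\dots,X_n^{-1}]]$. For $f\in R[X_1,\dots,X_n]$, $\delta f$ is the vector of partial degrees. For $\delta f\ge\mathbf 1$, the border polynomial is $\beta_0(f,s)=\sum_{\mathbf 1\le a\le\delta f}(f\cdot\Gamma(s))_aX^a$, where the product is taken in the Laurent series ring $R((X_1^{-1},\dots,X_n^{-1}))$ and $(\cdot)_a$ denotes the coefficient of $X^a$. For $a\ge\mathbf 0$, the generalized divided difference is $\nu^af=\sum_{a\le b\le\delta f}f_bX^{b-a}$ (empty sum $0$), where $f=\sum_bf_bX^b$. *)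

theory Defs
  imports "HOL-Analysis.Finite_Cartesian_Product" "HOL-Library.Poly_Mapping"
begin

text \<open>
  The variables are indexed by a finite type \<open>'n\<close> (so their number is \<open>CARD('n) \<ge> 1\<close>); exponent
  vectors are elements of \<open>nat ^ 'n\<close> or \<open>int ^ 'n\<close>, where \<open>0\<close>, \<open>1\<close>, \<open>\<le>\<close> and the interval notation
  of the library are componentwise. The type \<open>nat ^ 'n \<Rightarrow>\<^sub>0 'a\<close>, with the convolution product of
  \<open>Poly_Mapping\<close>, is the polynomial ring in these variables.
\<close>

type_synonym ('a, 'n) mpoly = "(nat ^ 'n) \<Rightarrow>\<^sub>0 'a"

definition ivec :: "nat ^ 'n \<Rightarrow> int ^ 'n" where
  "ivec a = (\<chi> i. int (a $ i))"

definition monom :: "nat ^ 'n \<Rightarrow> ('a::comm_ring_1, 'n::finite) mpoly" where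
  "monom a = Poly_Mapping.single a 1"

definition const :: "'a \<Rightarrow> ('a::comm_ring_1, 'n::finite) mpoly" where
  "const c = Poly_Mapping.single 0 c"

definition var :: "'n \<Rightarrow> ('a::comm_ring_1, 'n::finite) mpoly" where
  "var i = monom (axis i 1)"

text \<open>
  All partial degrees of the zero polynomial are \<open>0\<close> by convention.
\<close>

definition pdeg :: "('a::comm_ring_1, 'n::finite) mpoly \<Rightarrow> nat ^ 'n" (\<open>\<delta>\<close>) where
  "\<delta> f = (\<chi> i. Max (insert 0 ((\<lambda>b. b $ i) ` Poly_Mapping.keys f)))"

lemma finite_vec_interval_nat [simp]: "finite {a..b :: nat ^ 'n::finite}"
proof -
  have "inj_on vec_nth {a..b}" by (simp add: inj_on_def vec_nth_inject)
  moreover have "vec_nth ` {a..b} \<subseteq> (\<Pi>\<^sub>E i\<in>UNIV. {a $ i..b $ i})"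
    by (auto simp: less_eq_vec_def)
  moreover have "finite (\<Pi>\<^sub>E i\<in>UNIV. {a $ i..b $ i})" by (rule finite_PiE) auto
  ultimately show ?thesis
    by (meson finite_imageD finite_subset)
qed

lemma finite_vec_interval_int [simp]: "finite {a..b :: int ^ 'n::finite}"
proof -
  have "inj_on vec_nth {a..b}" by (simp add: inj_on_def vec_nth_inject)
  moreover have "vec_nth ` {a..b} \<subseteq> (\<Pi>\<^sub>E i\<in>UNIV. {a $ i..b $ i})"
    by (auto simp: less_eq_vec_def)
  moreover have "finite (\<Pi>\<^sub>E i\<in>UNIV. {a $ i..b $ i})" by (rule finite_PiE) auto
  ultimately show ?thesis
    by (meson finite_imageD finite_subset)
qed


section \<open>Laurent series in the inverse variables\<close>

text \<open>
  An element of \<open>R((X\<^sub>1\<^sup>-\<^sup>1, \<dots>, X\<^sub>n\<^sup>-\<^sup>1))\<close> is a formal series whose exponents are bounded above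
  componentwise, i.e. a monomial times an element of \<open>R[[X\<^sub>1\<^sup>-\<^sup>1, \<dots>, X\<^sub>n\<^sup>-\<^sup>1]]\<close>.
\<close>

typedef (overloaded) ('a::comm_ring_1, 'n::finite) laurent =
  "{F :: int ^ 'n \<Rightarrow> 'a. \<exists>u. \<forall>a. F a \<noteq> 0 \<longrightarrow> a \<le> u}"
  morphisms coeff Abs_laurent
  by (intro exI[of _ "\<lambda>_. 0"]) simp

setup_lifting type_definition_laurent

definition conv :: "(int ^ 'n \<Rightarrow> 'a) \<Rightarrow> (int ^ 'n \<Rightarrow> 'a) \<Rightarrow> int ^ 'n \<Rightarrow> 'a::comm_ring_1" where
  "conv F G a = Sum_any (\<lambda>b. F b * G (a - b))"

text \<open>
  For supports bounded by \<open>u\<close> and \<open>v\<close>, only the exponents \<open>b \<in> {a - v..u}\<close> contribute to the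
  coefficient at \<open>a\<close>, so \<open>Sum_any\<close> is a finite sum.
\<close>

lemma conv_superset:
  fixes F G :: "int ^ 'n::finite \<Rightarrow> 'a::comm_ring_1"
  assumes "\<And>a. F a \<noteq> 0 \<Longrightarrow> a \<le> u" "\<And>a. G a \<noteq> 0 \<Longrightarrow> a \<le> v"
    and "finite S" "{a - v..u} \<subseteq> S"
  shows "conv F G a = (\<Sum>b\<in>S. F b * G (a - b))"
  unfolding conv_def
proof (rule Sum_any.expand_superset[OF \<open>finite S\<close>])
  have "b \<in> {a - v..u}" if "F b * G (a - b) \<noteq> 0" for b
  proof -
    from that have "F b \<noteq> 0" "G (a - b) \<noteq> 0" by auto
    then have "b \<le> u" "a - b \<le> v" using assms(1,2) by auto
    then show ?thesis by (simp add: less_eq_vec_def algebra_simps)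
  qed
  then show "{b. F b * G (a - b) \<noteq> 0} \<subseteq> S" using assms(4) by blast
qed

lemma conv_bounded:
  fixes F G :: "int ^ 'n::finite \<Rightarrow> 'a::comm_ring_1"
  assumes "\<And>a. F a \<noteq> 0 \<Longrightarrow> a \<le> u" "\<And>a. G a \<noteq> 0 \<Longrightarrow> a \<le> v"
    and "conv F G a \<noteq> 0"
  shows "a \<le> u + v"
proof -
  have "(\<Sum>b\<in>{a - v..u}. F b * G (a - b)) \<noteq> 0"
    using conv_superset[of F u G v "{a - v..u}" a] assms by simp
  then obtain b where "a - v \<le> b" "b \<le> u"
    by (meson atLeastAtMost_iff sum.neutral)
  then have "a $ i - v $ i \<le> b $ i \<and> b $ i \<le> u $ i" for i
    by (simp add: less_eq_vec_def)
  then show ?thesis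
    by (simp add: less_eq_vec_def) (smt (verit))
qed

lemma conv_commute:
  fixes F G :: "int ^ 'n::finite \<Rightarrow> 'a::comm_ring_1"
  shows "conv F G a = conv G F a"
  unfolding conv_def
  by (rule Sum_any.reindex_cong[of "\<lambda>b. a - b"])
     (auto simp: inj_on_def mult.commute comp_def intro!: bij_betwI[of _ _ _ "\<lambda>b. a - b"])

lemma conv_assoc:
  fixes F G H :: "int ^ 'n::finite \<Rightarrow> 'a::comm_ring_1"
  assumes F: "\<And>a. F a \<noteq> 0 \<Longrightarrow> a \<le> u" and G: "\<And>a. G a \<noteq> 0 \<Longrightarrow> a \<le> v"
    and H: "\<And>a. H a \<noteq> 0 \<Longrightarrow> a \<le> w"
  shows "conv (conv F G) H a = conv F (conv G H) a"
proof -
  let ?B = "{a - w..u + v}" and ?C = "{a - (v + w)..u}"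
  have "conv (conv F G) H a = (\<Sum>b\<in>?B. conv F G b * H (a - b))"
    by (rule conv_superset[of _ "u + v" _ w]) (use conv_bounded[OF F G] H in auto)
  also have "\<dots> = (\<Sum>b\<in>?B. (\<Sum>c\<in>?C. F c * G (b - c)) * H (a - b))"
  proof (rule sum.cong[OF refl])
    fix b assume b: "b \<in> ?B"
    have "{b - v..u} \<subseteq> ?C"
    proof
      fix x assume "x \<in> {b - v..u}"
      then have "a $ i - w $ i \<le> b $ i \<and> b $ i - v $ i \<le> x $ i \<and> x $ i \<le> u $ i" for i
        using b by (simp add: less_eq_vec_def)
      then show "x \<in> ?C" by (simp add: less_eq_vec_def) (smt (verit))
    qed
    then show "conv F G b * H (a - b) = (\<Sum>c\<in>?C. F c * G (b - c)) * H (a - b)"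
      using conv_superset[of F u G v ?C b] F G by simp
  qed
  also have "\<dots> = (\<Sum>c\<in>?C. F c * (\<Sum>b\<in>?B. G (b - c) * H (a - b)))"
    by (simp add: sum_distrib_right sum_distrib_left mult.assoc) (rule sum.swap)
  also have "\<dots> = (\<Sum>c\<in>?C. F c * conv G H (a - c))"
  proof (rule sum.cong[OF refl])
    fix c assume c: "c \<in> ?C"
    let ?D = "(\<lambda>b. b - c) ` ?B"
    have "{a - c - w..v} \<subseteq> ?D"
    proof
      fix x assume x: "x \<in> {a - c - w..v}"
      have "a $ i - c $ i - w $ i \<le> x $ i \<and> x $ i \<le> v $ i \<and> c $ i \<le> u $ i" for i
        using x c by (simp add: less_eq_vec_def)
      then have "x + c \<in> ?B" by (simp add: less_eq_vec_def) (smt (verit))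
      then show "x \<in> ?D" by (intro image_eqI[of _ _ "x + c"]) auto
    qed
    then have "conv G H (a - c) = (\<Sum>d\<in>?D. G d * H (a - c - d))"
      using conv_superset[of G v H w ?D "a - c"] G H by simp
    also have "\<dots> = (\<Sum>b\<in>?B. G (b - c) * H (a - b))"
      by (subst sum.reindex) (auto simp: inj_on_def comp_def)
    finally show "F c * (\<Sum>b\<in>?B. G (b - c) * H (a - b)) = F c * conv G H (a - c)" by simp
  qed
  also have "\<dots> = conv F (conv G H) a"
    by (rule sym, rule conv_superset[of _ u _ "v + w"]) (use conv_bounded[OF G H] F in auto)
  finally show ?thesis .
qed

lemma conv_add_left:
  fixes F G H :: "int ^ 'n::finite \<Rightarrow> 'a::comm_ring_1"
  assumes F: "\<And>a. F a \<noteq> 0 \<Longrightarrow> a \<le> u" and G: "\<And>a. G a \<noteq> 0 \<Longrightarrow> a \<le> v"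
    and H: "\<And>a. H a \<noteq> 0 \<Longrightarrow> a \<le> w"
  shows "conv (\<lambda>a. F a + G a) H a = conv F H a + conv G H a"
proof -
  let ?t = "(\<chi> i. max (u $ i) (v $ i)) :: int ^ 'n"
  have t: "u \<le> ?t" "v \<le> ?t" by (auto simp: less_eq_vec_def)
  have FG: "b \<le> ?t" if "F b + G b \<noteq> 0" for b
    using that F[of b] G[of b] t order_trans by (metis add.right_neutral)
  have "conv (\<lambda>a. F a + G a) H a = (\<Sum>b\<in>{a - w..?t}. (F b + G b) * H (a - b))"
    by (rule conv_superset) (use FG H in auto)
  moreover have "conv F H a = (\<Sum>b\<in>{a - w..?t}. F b * H (a - b))"
    by (rule conv_superset[of _ u _ w]) (use F H t order_trans in auto)
  moreover have "conv G H a = (\<Sum>b\<in>{a - w..?t}. G b * H (a - b))"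
    by (rule conv_superset[of _ v _ w]) (use G H t order_trans in auto)
  ultimately show ?thesis by (simp add: distrib_right sum.distrib)
qed

lemma conv_one_left:
  fixes F :: "int ^ 'n::finite \<Rightarrow> 'a::comm_ring_1"
  shows "conv (\<lambda>a. if a = 0 then 1 else 0) F a = F a"
proof -
  have "(\<lambda>b. (if b = 0 then 1 else 0) * F (a - b)) = (\<lambda>b. if b = 0 then F a else 0)"
    by auto
  then show ?thesis unfolding conv_def by (simp only: Sum_any.delta)
qed

instantiation laurent :: (comm_ring_1, finite) comm_ring_1
begin

lift_definition zero_laurent :: "('a, 'b) laurent" is "\<lambda>_. 0" by simp

lift_definition one_laurent :: "('a, 'b) laurent" is "\<lambda>a. if a = 0 then 1 else 0"
  by (intro exI[of _ 0]) simp

lift_definition plus_laurent :: "('a, 'b) laurent \<Rightarrow> ('a, 'b) laurent \<Rightarrow> ('a, 'b) laurent"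
  is "\<lambda>F G a. F a + G a"
proof -
  fix F G :: "int ^ 'b \<Rightarrow> 'a"
  assume "\<exists>u. \<forall>a. F a \<noteq> 0 \<longrightarrow> a \<le> u" "\<exists>u. \<forall>a. G a \<noteq> 0 \<longrightarrow> a \<le> u"
  then obtain u v where "\<And>a. F a \<noteq> 0 \<Longrightarrow> a \<le> u" "\<And>a. G a \<noteq> 0 \<Longrightarrow> a \<le> v" by blast
  moreover have "u \<le> (\<chi> i. max (u $ i) (v $ i))" "v \<le> (\<chi> i. max (u $ i) (v $ i))"
    by (auto simp: less_eq_vec_def)
  ultimately show "\<exists>u. \<forall>a. F a + G a \<noteq> 0 \<longrightarrow> a \<le> u"
    by (metis add.right_neutral order_trans)
qed

lift_definition uminus_laurent :: "('a, 'b) laurent \<Rightarrow> ('a, 'b) laurent" is "\<lambda>F a. - F a"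
  by simp

definition minus_laurent :: "('a, 'b) laurent \<Rightarrow> ('a, 'b) laurent \<Rightarrow> ('a, 'b) laurent" where
  "minus_laurent F G = F + - G"

lift_definition times_laurent :: "('a, 'b) laurent \<Rightarrow> ('a, 'b) laurent \<Rightarrow> ('a, 'b) laurent"
  is conv
  using conv_bounded by metis

instance
proof
  fix F G H :: "('a, 'b) laurent"
  show "F + G + H = F + (G + H)" by transfer (simp add: add.assoc)
  show "F + G = G + F" by transfer (simp add: add.commute)
  show "0 + F = F" by transfer simp
  show "- F + F = 0" by transfer simp
  show "F - G = F + - G" by (simp add: minus_laurent_def)
  show "F * G * H = F * (G * H)" by transfer (auto intro!: conv_assoc)
  show "F * G = G * F" by transfer (intro ext conv_commute)
  show "1 * F = F" by transfer (simp add: conv_one_left fun_eq_iff)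
  show "(F + G) * H = F * H + G * H"
    by transfer (auto intro!: conv_add_left)
  show "(0 :: ('a, 'b) laurent) \<noteq> 1" by transfer (metis zero_neq_one)
qed

end

lift_definition laurent_of_poly :: "('a::comm_ring_1, 'n::finite) mpoly \<Rightarrow> ('a, 'n) laurent"
  is "\<lambda>f a. if 0 \<le> a then Poly_Mapping.lookup f (\<chi> i. nat (a $ i)) else 0"
proof -
  fix f :: "('a, 'n) mpoly"
  show "\<exists>u. \<forall>a. (if 0 \<le> a then Poly_Mapping.lookup f (\<chi> i. nat (a $ i)) else 0) \<noteq> 0 \<longrightarrow> a \<le> u"
  proof (intro exI allI impI)
    fix a :: "int ^ 'n"
    assume "(if 0 \<le> a then Poly_Mapping.lookup f (\<chi> i. nat (a $ i)) else 0) \<noteq> 0"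
    then have *: "0 \<le> a" "(\<chi> i. nat (a $ i)) \<in> Poly_Mapping.keys f"
      by (auto split: if_splits simp: in_keys_iff)
    have "nat (a $ i) \<le> \<delta> f $ i" for i
      using imageI[OF *(2), of "\<lambda>b. b $ i"] by (simp add: pdeg_def)
    then show "a \<le> ivec (\<delta> f)"
      by (simp add: less_eq_vec_def ivec_def nat_le_iff)
  qed
qed


section \<open>Sequences, border polynomials and divided differences\<close>

text \<open>
  A sequence is given by a function on \<open>int ^ 'n\<close> of which only the values at \<open>a \<le> 0\<close> are used.
\<close>

type_synonym ('a, 'n) seq = "int ^ 'n \<Rightarrow> 'a"

lift_definition gen_fun :: "('a::comm_ring_1, 'n::finite) seq \<Rightarrow> ('a, 'n) laurent" (\<open>\<Gamma>\<close>)
  is "\<lambda>s a. if a \<le> 0 then s a else 0"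
  by (intro exI[of _ 0]) simp

definition border_poly :: "('a::comm_ring_1, 'n::finite) mpoly \<Rightarrow> ('a, 'n) seq \<Rightarrow> ('a, 'n) mpoly"
  (\<open>\<beta>\<^sub>0\<close>) where
  "\<beta>\<^sub>0 f s = (\<Sum>a\<in>{1..\<delta> f}. const (coeff (laurent_of_poly f * \<Gamma> s) (ivec a)) * monom a)"

definition divided_diff :: "nat ^ 'n \<Rightarrow> ('a::comm_ring_1, 'n::finite) mpoly \<Rightarrow> ('a, 'n) mpoly"
  (\<open>\<nu>\<close>) where
  "\<nu> a f = (\<Sum>b\<in>{a..\<delta> f}. const (Poly_Mapping.lookup f b) * monom (b - a))"

end

theory Submission
  imports Defs
begin

text \<open>
  Both sides expand to the same double sum. For \<open>c \<ge> 0\<close> the coefficient of \<open>f \<cdot> \<Gamma>(s)\<close> at \<open>X\<^sup>c\<close>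
  is \<open>\<Sum>\<^bsub>c \<le> b \<le> \<delta> f\<^esub> f\<^sub>b s\<^bsub>c - b\<^esub>\<close>, because \<open>\<Gamma>(s)\<close> has only exponents \<open>\<le> 0\<close> and
  \<open>f\<close> only exponents \<open>\<le> \<delta> f\<close>. So the border polynomial is the sum of the terms
  \<open>f\<^sub>b s\<^bsub>c - b\<^esub> X\<^sup>c\<close> over \<open>1 \<le> c \<le> b \<le> \<delta> f\<close>. Grouping these terms by \<open>a = b - c\<close> instead of \<open>c\<close>
  turns the range into \<open>a + 1 \<le> b \<le> \<delta> f\<close> and the term into
  \<open>s\<^bsub>-a\<^esub> f\<^sub>b X\<^bsup>b - a\<^esup> = X\<^sup>1 \<cdot> s\<^bsub>-a\<^esub> f\<^sub>b X\<^bsup>b - (a + 1)\<^esup>\<close>, and for a fixed \<open>a\<close> these add up to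
  \<open>X\<^sup>1 s\<^bsub>-a\<^esub> \<nu>\<^bsup>a + 1\<^esup> f\<close>. The exponent \<open>1\<close> is the all-ones vector, so \<open>X\<^sup>1\<close> is the product of
  the variables.
\<close>

lemma monom_mult_monom: "monom a * monom b = monom (a + b)"
  by (simp add: monom_def mult_single)

lemma const_mult_const: "const c * const d = const (c * d)"
  by (simp add: const_def mult_single)

lemma const_sum: "const (sum g A) = (\<Sum>x\<in>A. const (g x))"
  unfolding const_def by (induction A rule: infinite_finite_induct) (simp_all add: single_add)

lemma prod_monom: "finite A \<Longrightarrow> (\<Prod>x\<in>A. monom (g x)) = monom (\<Sum>x\<in>A. g x)"
  by (induction A rule: finite_induct) (simp_all add: monom_mult_monom, simp add: monom_def)

lemma prod_var_UNIV: "(\<Prod>i\<in>UNIV. var i) = (monom 1 :: ('a::comm_ring_1, 'n::finite) mpoly)"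
proof -
  have "(\<Sum>i\<in>UNIV. axis i 1) = (1 :: nat ^ 'n)"
    by (simp add: vec_eq_iff axis_def)
  then show ?thesis by (simp only: var_def prod_monom finite)
qed

lemma lookup_nonzero_le_pdeg: "Poly_Mapping.lookup f b \<noteq> 0 \<Longrightarrow> b \<le> \<delta> f"
  by (auto simp: less_eq_vec_def pdeg_def in_keys_iff intro!: Max_ge)

lemma inj_ivec: "inj ivec"
  by (simp add: inj_on_def ivec_def vec_eq_iff)

lemma ivec_image_atLeastAtMost: "ivec ` {a..b} = {ivec a..ivec b}"
proof (intro equalityI subsetI)
  fix x assume x: "x \<in> {ivec a..ivec b}"
  then have i: "int (a $ i) \<le> x $ i" "x $ i \<le> int (b $ i)" for i
    by (auto simp: less_eq_vec_def ivec_def)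
  then have nonneg: "0 \<le> x $ i" for i
    by (meson of_nat_0_le_iff order_trans)
  have "x = ivec (\<chi> i. nat (x $ i))"
    by (simp add: ivec_def vec_eq_iff nonneg)
  moreover have "(\<chi> i. nat (x $ i)) \<in> {a..b}"
    using i nonneg by (simp add: less_eq_vec_def le_nat_iff nat_le_iff)
  ultimately show "x \<in> ivec ` {a..b}" by blast
qed (auto simp: less_eq_vec_def ivec_def)

lemma coeff_laurent_of_poly_ivec:
  "coeff (laurent_of_poly f) (ivec b) = Poly_Mapping.lookup f b"
  by (simp add: laurent_of_poly.rep_eq ivec_def less_eq_vec_def)

lemma coeff_laurent_of_poly_le:
  assumes "coeff (laurent_of_poly f) a \<noteq> 0"
  shows "a \<le> ivec (\<delta> f)"
proof -
  let ?b = "\<chi> i. nat (a $ i)"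
  have "0 \<le> a" "Poly_Mapping.lookup f ?b \<noteq> 0"
    using assms by (auto simp: laurent_of_poly.rep_eq split: if_splits)
  then have "a = ivec ?b" "?b \<le> \<delta> f"
    by (auto simp: ivec_def vec_eq_iff less_eq_vec_def dest: lookup_nonzero_le_pdeg)
  then show ?thesis
    by (simp add: ivec_def less_eq_vec_def nat_le_iff)
qed

lemma coeff_laurent_of_poly_mult_gen_fun:
  "coeff (laurent_of_poly f * \<Gamma> s) (ivec c) =
     (\<Sum>b\<in>{c..\<delta> f}. Poly_Mapping.lookup f b * s (ivec c - ivec b))"
proof -
  have "coeff (laurent_of_poly f * \<Gamma> s) (ivec c) =
      (\<Sum>x\<in>{ivec c..ivec (\<delta> f)}. coeff (laurent_of_poly f) x * coeff (\<Gamma> s) (ivec c - x))"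
    unfolding times_laurent.rep_eq
    by (rule conv_superset[where u = "ivec (\<delta> f)" and v = 0])
       (auto simp: coeff_laurent_of_poly_le gen_fun.rep_eq split: if_splits)
  also have "\<dots> = (\<Sum>b\<in>{c..\<delta> f}. Poly_Mapping.lookup f b * coeff (\<Gamma> s) (ivec c - ivec b))"
    unfolding ivec_image_atLeastAtMost[symmetric]
    by (subst sum.reindex) (auto intro: inj_on_subset[OF inj_ivec] simp: coeff_laurent_of_poly_ivec)
  also have "\<dots> = (\<Sum>b\<in>{c..\<delta> f}. Poly_Mapping.lookup f b * s (ivec c - ivec b))"
    by (intro sum.cong refl) (simp add: gen_fun.rep_eq less_eq_vec_def ivec_def)
  finally show ?thesis .
qed

text \<open>
  The reindexing \<open>a = b - c\<close>. Subtraction on \<open>nat ^ 'n\<close> is truncated, but \<open>c \<le> b\<close> and \<open>a + 1 \<le> b\<close>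
  on the respective sides make \<open>c \<mapsto> b - c\<close> and \<open>a \<mapsto> b - a\<close> inverse to each other.
\<close>

lemma sum_vec_triangle_reindex:
  fixes d :: "nat ^ 'n::finite" and h :: "nat ^ 'n \<Rightarrow> nat ^ 'n \<Rightarrow> 'b::comm_monoid_add"
  shows "(\<Sum>c\<in>{1..d}. \<Sum>b\<in>{c..d}. h c b) = (\<Sum>a\<in>{0..d - 1}. \<Sum>b\<in>{a + 1..d}. h (b - a) b)"
proof -
  have "(\<Sum>(c, b)\<in>(SIGMA c:{1..d}. {c..d}). h c b) =
      (\<Sum>(a, b)\<in>(SIGMA a:{0..d - 1}. {a + 1..d}). h (b - a) b)"
  proof (rule sum.reindex_bij_witness[of _ "\<lambda>(a, b). (b - a, b)" "\<lambda>(c, b). (b - c, b)"])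
    fix x assume "x \<in> (SIGMA c:{1..d}. {c..d})"
    then obtain c b where x: "x = (c, b)" and range: "1 \<le> c" "c \<le> b" "b \<le> d"
      by auto
    then have le: "Suc 0 \<le> c $ i \<and> c $ i \<le> b $ i \<and> b $ i \<le> d $ i" for i
      by (simp add: less_eq_vec_def)
    have "b - (b - c) = c"
      using le by (simp add: vec_eq_iff)
    moreover have "b $ i - c $ i \<le> d $ i - Suc 0" "Suc (b $ i - c $ i) \<le> b $ i" for i
      using le[of i] by arith+
    ultimately show "(case case x of (c, b) \<Rightarrow> (b - c, b) of (a, b) \<Rightarrow> (b - a, b)) = x"
      and "(case x of (c, b) \<Rightarrow> (b - c, b)) \<in> (SIGMA a:{0..d - 1}. {a + 1..d})"
      and "(case case x of (c, b) \<Rightarrow> (b - c, b) of (a, b) \<Rightarrow> h (b - a) b) = (case x of (c, b) \<Rightarrow> h c b)"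
      using range by (simp_all add: x less_eq_vec_def)
  next
    fix y assume "y \<in> (SIGMA a:{0..d - 1}. {a + 1..d})"
    then obtain a b where y: "y = (a, b)" and range: "a + 1 \<le> b" "b \<le> d"
      by auto
    then have le: "Suc (a $ i) \<le> b $ i \<and> b $ i \<le> d $ i" for i
      by (simp add: less_eq_vec_def)
    have "a $ i \<le> b $ i" for i
      using le[of i] by arith
    then have "b - (b - a) = a"
      by (simp add: vec_eq_iff)
    moreover have "Suc 0 \<le> b $ i - a $ i" "b $ i - a $ i \<le> b $ i" for i
      using le[of i] by arith+
    moreover have "b $ i - a $ i \<le> d $ i" for i
      using le[of i] by arith
    ultimately show "(case case y of (a, b) \<Rightarrow> (b - a, b) of (c, b) \<Rightarrow> (b - c, b)) = y"
      and "(case y of (a, b) \<Rightarrow> (b - a, b)) \<in> (SIGMA c:{1..d}. {c..d})"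
      using range by (simp_all add: y less_eq_vec_def)
  qed
  then show ?thesis by (simp add: sum.Sigma)
qed

theorem lemma3p4:
  fixes s :: "('a::comm_ring_1, 'n::finite) seq" and f :: "('a, 'n) mpoly"
  assumes "1 \<le> \<delta> f"
  shows "\<beta>\<^sub>0 f s = (\<Prod>i\<in>UNIV. var i) * (\<Sum>a\<in>{0..\<delta> f - 1}. const (s (- ivec a)) * \<nu> (a + 1) f)"
proof -
  have "\<beta>\<^sub>0 f s = (\<Sum>c\<in>{1..\<delta> f}. \<Sum>b\<in>{c..\<delta> f}.
      const (Poly_Mapping.lookup f b * s (ivec c - ivec b)) * monom c)"
    by (simp add: border_poly_def coeff_laurent_of_poly_mult_gen_fun const_sum sum_distrib_right)
  also have "\<dots> = (\<Sum>a\<in>{0..\<delta> f - 1}. \<Sum>b\<in>{a + 1..\<delta> f}.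
      const (Poly_Mapping.lookup f b * s (ivec (b - a) - ivec b)) * monom (b - a))"
    by (rule sum_vec_triangle_reindex)
  also have "\<dots> = (\<Sum>a\<in>{0..\<delta> f - 1}. \<Sum>b\<in>{a + 1..\<delta> f}.
      monom 1 * (const (s (- ivec a)) * (const (Poly_Mapping.lookup f b) * monom (b - (a + 1)))))"
  proof (intro sum.cong refl)
    fix a b assume "b \<in> {a + 1..\<delta> f}"
    then have le: "Suc (a $ i) \<le> b $ i" for i
      by (simp add: less_eq_vec_def)
    have "1 + (b - (a + 1)) = b - a"
      using le by (simp add: vec_eq_iff Suc_diff_Suc Suc_le_eq)
    then have shift: "monom (b - a) = monom 1 * (monom (b - (a + 1)) :: ('a, 'n) mpoly)"
      by (simp add: monom_mult_monom)
    have "ivec (b - a) - ivec b = - ivec a"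
      using le by (simp add: vec_eq_iff ivec_def of_nat_diff Suc_leD)
    then show "const (Poly_Mapping.lookup f b * s (ivec (b - a) - ivec b)) * monom (b - a) =
        monom 1 * (const (s (- ivec a)) * (const (Poly_Mapping.lookup f b) * monom (b - (a + 1))))"
      by (simp add: shift const_mult_const[symmetric] mult_ac)
  qed
  also have "\<dots> = (\<Prod>i\<in>UNIV. var i) *
      (\<Sum>a\<in>{0..\<delta> f - 1}. const (s (- ivec a)) * \<nu> (a + 1) f)"
    by (simp add: prod_var_UNIV divided_diff_def sum_distrib_left)
  finally show ?thesis .
qed

end
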